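(* For every unsatisfiable hitting clause-set $F$, $\mathrm{singind}(F)\le 2\,\mathrm{nosv}(F)+\mathrm{nnosv}(F)$.
   Context: Variables are positive integers, literals are nonzero integers, the complement of $x$ is $\overline{x}=-x$. A clause is a finite set of literals with no pair $x,\overline{x}$; a clause-set is a finite set of clauses. $F$ is satisfiable if some clause meets every clause of $F$, otherwise unsatisfiable. $F$ is hitting if any two distinct clauses $C,D\in F$ have some $x\in C$ with $\overline{x}\in D$. $\mathrm{ldeg}_F(x)$ is the number of clauses containing $x$; a variable $v$ of $F$ is singular if $\min(\mathrm{ldeg}_F(v),\mathrm{ldeg}_F(\overline v))=1$, and $1$-singular if moreover $\mathrm{ldeg}_F(v)+\mathrm{ldeg}_F(\overline v)=2$. $\mathrm{nosv}(F)$ is the number of $1$-singular variables of $F$, and $\mathrm{nnosv}(F)$ the number of singular variables of $F$ that are not $1$-singular. For a singular variable $v$, singular DP-reduction replaces $F$ by $\mathrm{DP}_v(F):=\{(A\cup B)\setminus\{v,\overline v\}: A,B\in F, A\cap\overline{B}=\{v\}\}\cup\{A\in F: v \text{ does not occur in } A\}$. For an unsatisfiable hitting clause-set $F$, every maximal sequence of singular DP-reductions has the same length, denoted $\mathrm{singind}(F)$. *)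

theory Defs
  imports Main
begin

type_synonym literal = int
type_synonym clause = "literal set"

definition is_clause :: "clause \<Rightarrow> bool" where
  "is_clause C \<longleftrightarrow> finite C \<and> 0 \<notin> C \<and> (\<forall>x\<in>C. - x \<notin> C)"

definition is_clause_set :: "clause set \<Rightarrow> bool" where
  "is_clause_set F \<longleftrightarrow> finite F \<and> (\<forall>C\<in>F. is_clause C)"

definition satisfiable :: "clause set \<Rightarrow> bool" where
  "satisfiable F \<longleftrightarrow> (\<exists>\<phi>. is_clause \<phi> \<and> (\<forall>C\<in>F. \<phi> \<inter> C \<noteq> {}))"

definition hitting :: "clause set \<Rightarrow> bool" where
  "hitting F \<longleftrightarrow> (\<forall>C\<in>F. \<forall>D\<in>F. C \<noteq> D \<longrightarrow> (\<exists>x\<in>C. - x \<in> D))"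

definition var :: "clause set \<Rightarrow> int set" where
  "var F = abs ` \<Union>F"

definition ldeg :: "clause set \<Rightarrow> literal \<Rightarrow> nat" where
  "ldeg F x = card {C \<in> F. x \<in> C}"

definition singular :: "clause set \<Rightarrow> int \<Rightarrow> bool" where
  "singular F v \<longleftrightarrow> v \<in> var F \<and> min (ldeg F v) (ldeg F (- v)) = 1"

definition one_singular :: "clause set \<Rightarrow> int \<Rightarrow> bool" where
  "one_singular F v \<longleftrightarrow> singular F v \<and> ldeg F v + ldeg F (- v) = 2"

definition nosv :: "clause set \<Rightarrow> nat" where
  "nosv F = card {v. one_singular F v}"

definition nnosv :: "clause set \<Rightarrow> nat" where
  "nnosv F = card {v. singular F v \<and> \<not> one_singular F v}"

definition DP :: "int \<Rightarrow> clause set \<Rightarrow> clause set" where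
  "DP v F = {(A \<union> B) - {v, - v} | A B. A \<in> F \<and> B \<in> F \<and> A \<inter> uminus ` B = {v}}
            \<union> {A \<in> F. v \<notin> A \<and> - v \<notin> A}"

definition sDP :: "clause set \<Rightarrow> clause set \<Rightarrow> bool" where
  "sDP F G \<longleftrightarrow> (\<exists>v. singular F v \<and> G = DP v F)"

text \<open>The common length of all maximal sequences of singular DP-reductions starting from
  \<open>F\<close>; such a common length exists whenever \<open>F\<close> is an unsatisfiable hitting clause-set.\<close>

definition singind :: "clause set \<Rightarrow> nat" where
  "singind F = (THE n. \<exists>G. (sDP ^^ n) F G \<and> (\<nexists>H. sDP G H))"

end

theory Submission imports Defs begin

text \<open>Let \<open>x\<close> be a literal of an unsatisfiable hitting clause-set \<open>F\<close> occurring in exactly one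
  clause \<open>C\<close>. Then every clause containing \<open>-x\<close> also contains \<open>C - {x}\<close>, so DP-reduction on the
  variable of \<open>x\<close> amounts to setting \<open>x\<close> to true. Hence singular DP-reductions of \<open>F\<close> commute,
  and all maximal reduction sequences have the same length. Moreover the only literal degrees that
  drop are those of \<open>C - {x}\<close>, each by one. A new (1-)singular variable can thus only arise if
  \<open>x\<close> is 1-singular, from a literal of degree 2 in \<open>C - {x}\<close>, and there is at most one such
  literal. Therefore \<open>2 nosv + nnosv\<close> drops with every reduction.\<close>

section \<open>Unsatisfiable hitting clause-sets and truth assignments\<close>

definition uhit :: "clause set \<Rightarrow> bool" where
  "uhit F \<longleftrightarrow> is_clause_set F \<and> \<not> satisfiable F \<and> hitting F"

text \<open>The restriction of \<open>F\<close> by the partial assignment making \<open>x\<close>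
  true. Indexing by a literal rather than a variable lets both signs of a singular variable be
  treated alike.\<close>

definition assign :: "literal \<Rightarrow> clause set \<Rightarrow> clause set" where
  "assign x F = (\<lambda>D. D - {- x}) ` {D \<in> F. x \<notin> D}"

lemma uhit_clauseD:
  assumes "uhit F" "C \<in> F"
  shows "finite C" "0 \<notin> C" "x \<in> C \<Longrightarrow> - x \<notin> C"
  using assms by (auto simp: uhit_def is_clause_set_def is_clause_def)

lemma uhit_finite: "uhit F \<Longrightarrow> finite F"
  by (simp add: uhit_def is_clause_set_def)

lemma uhit_clash:
  assumes "uhit F" "C \<in> F" "D \<in> F" "C \<noteq> D"
  obtains z where "z \<in> C" "- z \<in> D"
  using assms unfolding uhit_def hitting_def by blast

lemma uhit_falsified:
  assumes "uhit F" "is_clause \<phi>"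
  obtains E where "E \<in> F" "\<phi> \<inter> E = {}"
  using assms unfolding uhit_def satisfiable_def by blast

text \<open>Make \<open>y\<close> true and all other literals of \<open>E\<close> false. Some clause
  \<open>H\<close> is not satisfied by this; it differs from \<open>E\<close>, so it clashes with
  \<open>E\<close>. The clash can only be on \<open>y\<close>, since the complements of the other
  literals of \<open>E\<close> are true and hence absent from \<open>H\<close>.\<close>

lemma uhit_complement_occurs:
  assumes F: "uhit F" and E: "E \<in> F" "y \<in> E"
  shows "\<exists>B\<in>F. - y \<in> B"
proof -
  note cl = uhit_clauseD[OF F E(1)]
  have "is_clause (insert y (uminus ` (E - {y})))"
    using cl E(2) unfolding is_clause_def by auto
  then obtain H where H: "H \<in> F" "insert y (uminus ` (E - {y})) \<inter> H = {}"
    using uhit_falsified[OF F] by blast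
  then have "H \<noteq> E" using E by auto
  then obtain u where u: "u \<in> H" "- u \<in> E" using uhit_clash[OF F H(1) E(1)] by blast
  have "- u = y"
  proof (rule ccontr)
    assume "- u \<noteq> y"
    then have "- (- u) \<in> uminus ` (E - {y})" using u(2) by blast
    then show False using u(1) H(2) by auto
  qed
  then have "- y \<in> H" using u(1) by auto
  then show ?thesis using H(1) by blast
qed

section \<open>DP-reduction on a literal of degree 1 as an assignment\<close>

text \<open>If \<open>y\<close> were missing from \<open>D\<close>, one could falsify
  \<open>D\<close> except for \<open>- x\<close> and make \<open>- x\<close> and \<open>y\<close>
  true. This satisfies \<open>D\<close> and \<open>C\<close>, so an unsatisfied clause
  \<open>E\<close> is neither of them and avoids both \<open>x\<close> and \<open>- x\<close>. Its
  clash with \<open>D\<close> then lies on a literal that the assignment makes true in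
  \<open>E\<close>.\<close>

lemma main_clause_subset_side_clause:
  assumes F: "uhit F" and C: "{D \<in> F. x \<in> D} = {C}" and D: "D \<in> F" "- x \<in> D"
  shows "C - {x} \<subseteq> D"
proof
  fix y assume y: "y \<in> C - {x}"
  show "y \<in> D"
  proof (rule ccontr)
    assume yD: "y \<notin> D"
    have CF: "C \<in> F" "x \<in> C" using C by auto
    let ?\<phi> = "uminus ` (D - {- x}) \<union> {- x, y}"
    have "x \<noteq> 0" "y \<noteq> 0" "- x \<noteq> - y" using uhit_clauseD[OF F CF(1)] y CF by auto
    then have "is_clause ?\<phi>"
      using uhit_clauseD[OF F D(1)] uhit_clauseD[OF F CF(1)] y yD CF(2)
      unfolding is_clause_def by auto
    then obtain E where E: "E \<in> F" "?\<phi> \<inter> E = {}" using uhit_falsified[OF F] by blast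
    have "- x \<notin> E" "y \<notin> E" using E by auto
    then have "E \<noteq> D" "E \<noteq> C" using D y by auto
    then have "x \<notin> E" using C E(1) by auto
    obtain z where z: "z \<in> E" "- z \<in> D" using uhit_clash[OF F E(1) D(1) \<open>E \<noteq> D\<close>] by blast
    then have "- z \<noteq> - x" using \<open>x \<notin> E\<close> by auto
    then have "- (- z) \<in> uminus ` (D - {- x})" using z by blast
    then show False using z E by auto
  qed
qed

lemma uhit_assign:
  assumes F: "uhit F" and x: "x \<noteq> 0"
  shows "uhit (assign x F)"
proof -
  have "is_clause_set (assign x F)"
    using F unfolding uhit_def is_clause_set_def is_clause_def assign_def by auto
  moreover have "hitting (assign x F)"
    unfolding hitting_def
  proof (intro ballI impI)
    fix A B assume AB: "A \<in> assign x F" "B \<in> assign x F" "A \<noteq> B"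
    then obtain D E where DE: "D \<in> F" "E \<in> F" "x \<notin> D" "x \<notin> E" "A = D - {- x}" "B = E - {- x}"
      unfolding assign_def by auto
    with AB obtain z where z: "z \<in> D" "- z \<in> E" using uhit_clash[OF F, of D E] by blast
    \<comment> \<open>A clash on the variable of \<open>x\<close> would put \<open>x\<close> into
      \<open>D\<close> or \<open>E\<close>, so the clash survives the deletion of
      \<open>- x\<close>.\<close>
    then have "z \<noteq> - x" "- z \<noteq> - x" using DE by auto
    then show "\<exists>z\<in>A. - z \<in> B" using z DE by auto
  qed
  moreover have "\<not> satisfiable (assign x F)"
  proof
    assume "satisfiable (assign x F)"
    then obtain \<phi> where \<phi>: "is_clause \<phi>" "\<forall>C\<in>assign x F. \<phi> \<inter> C \<noteq> {}"
      unfolding satisfiable_def by blast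
    have "is_clause (insert x (\<phi> - {- x}))"
      using \<phi>(1) x unfolding is_clause_def by auto
    moreover have "insert x (\<phi> - {- x}) \<inter> C \<noteq> {}" if "C \<in> F" for C
    proof (cases "x \<in> C")
      case False
      then have "\<phi> \<inter> (C - {- x}) \<noteq> {}" using that \<phi>(2) unfolding assign_def by blast
      then show ?thesis by auto
    qed auto
    ultimately show False using F unfolding uhit_def satisfiable_def by blast
  qed
  ultimately show ?thesis by (simp add: uhit_def)
qed

text \<open>The only resolution partner for a clause \<open>B\<close> with \<open>- x\<close> is
  \<open>C\<close>. As \<open>B\<close> contains \<open>C - {x}\<close>, there is no second clash,
  and the resolvent is just \<open>B - {- x}\<close>. The version for \<open>- x\<close> covers
  singular variables whose negative literal has degree 1; it swaps the roles of the two
  parents.\<close>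

lemma DP_eq_assign:
  assumes F: "uhit F" and C: "{D \<in> F. x \<in> D} = {C}"
  shows "DP x F = assign x F" "DP (- x) F = assign x F"
proof -
  have CF: "C \<in> F" "x \<in> C" using C by auto
  have only: "A = C" if "A \<in> F" "x \<in> A" for A using that C by auto
  note cl = uhit_clauseD[OF F]
  have sub: "C - {x} \<subseteq> B" if "B \<in> F" "- x \<in> B" for B
    using main_clause_subset_side_clause[OF F C that] .
  have res: "C \<inter> uminus ` B = {x}" "B \<inter> uminus ` C = {- x}"
    "(C \<union> B) - {x, - x} = B - {- x}" "x \<notin> B" if B: "B \<in> F" "- x \<in> B" for B
  proof -
    show x: "x \<notin> B" using cl(3)[OF B(1), of x] B(2) by auto
    have neg: "- z \<notin> B" if "z \<in> C" "z \<noteq> x" for z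
      using cl(3)[OF B(1), of z] sub[OF B] that by auto
    show "C \<inter> uminus ` B = {x}"
    proof (intro equalityI subsetI)
      fix z assume z: "z \<in> C \<inter> uminus ` B"
      then have "- z \<in> B" by auto
      then show "z \<in> {x}" using neg[of z] z by auto
    qed (use CF B in \<open>auto intro: image_eqI[of _ _ "- x"]\<close>)
    show "B \<inter> uminus ` C = {- x}"
      using neg CF B by auto
    show "(C \<union> B) - {x, - x} = B - {- x}"
      using sub[OF B] x by auto
  qed
  have side: "(\<lambda>B. B - {- x}) ` {B \<in> F. - x \<in> B} \<union> {A \<in> F. x \<notin> A \<and> - x \<notin> A} = assign x F"
    unfolding assign_def using res(4) by (auto simp: image_iff)
  have "{(A \<union> B) - {x, - x} | A B. A \<in> F \<and> B \<in> F \<and> A \<inter> uminus ` B = {x}}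
      = (\<lambda>B. B - {- x}) ` {B \<in> F. - x \<in> B}" (is "?L = ?R")
  proof (intro equalityI subsetI)
    fix R assume "R \<in> ?L"
    then obtain A B where AB: "R = (A \<union> B) - {x, - x}" "A \<in> F" "B \<in> F" "A \<inter> uminus ` B = {x}"
      by blast
    have "x \<in> A \<inter> uminus ` B" using AB(4) by simp
    then have "x \<in> A" "- x \<in> B" by auto
    moreover from this have "R = B - {- x}" using AB only res(3) by simp
    ultimately show "R \<in> ?R" using AB(3) by simp
  next
    fix R assume "R \<in> ?R"
    then obtain B where B: "B \<in> F" "- x \<in> B" "R = B - {- x}" by blast
    have "R = (C \<union> B) - {x, - x}" using res(3)[OF B(1,2)] B(3) by simp
    then show "R \<in> ?L" using res(1)[OF B(1,2)] B(1) CF(1) by blast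
  qed
  then show "DP x F = assign x F" using side unfolding DP_def by simp
  have "{(A \<union> B) - {- x, - (- x)} | A B. A \<in> F \<and> B \<in> F \<and> A \<inter> uminus ` B = {- x}}
      = (\<lambda>B. B - {- x}) ` {B \<in> F. - x \<in> B}" (is "?L = ?R")
  proof (intro equalityI subsetI)
    fix R assume "R \<in> ?L"
    then obtain A B where AB: "R = (B \<union> A) - {x, - x}" "A \<in> F" "B \<in> F" "A \<inter> uminus ` B = {- x}"
      by auto
    have "- x \<in> A \<inter> uminus ` B" using AB(4) by simp
    then have "- x \<in> A" "x \<in> B" by auto
    moreover from this have "R = A - {- x}" using AB only res(3) by simp
    ultimately show "R \<in> ?R" using AB(2) by simp
  next
    fix R assume "R \<in> ?R"
    then obtain B where B: "B \<in> F" "- x \<in> B" "R = B - {- x}" by blast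
    have "R = (B \<union> C) - {- x, - (- x)}" using res(3)[OF B(1,2)] B(3) by auto
    then show "R \<in> ?L" using res(2)[OF B(1,2)] B(1) CF(1) by blast
  qed
  moreover have "{A \<in> F. - x \<notin> A \<and> - (- x) \<notin> A} = {A \<in> F. x \<notin> A \<and> - x \<notin> A}" by auto
  ultimately show "DP (- x) F = assign x F" using side unfolding DP_def by simp
qed

section \<open>Literal degrees and singularity\<close>

text \<open>Deleting \<open>- x\<close> identifies no two remaining clauses, because they clash on a
  literal outside the variable of \<open>x\<close>. So the only loss in the count is
  \<open>C\<close> itself.\<close>

lemma ldeg_assign:
  assumes F: "uhit F" and C: "{D \<in> F. x \<in> D} = {C}" and y: "y \<noteq> - x"
  shows "ldeg (assign x F) y = ldeg F y - (if y \<in> C then 1 else 0)"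
proof -
  have CF: "C \<in> F" using C by blast
  have main: "x \<in> D \<longleftrightarrow> D = C" if "D \<in> F" for D using C that by blast
  have inj: "inj_on (\<lambda>D. D - {- x}) {D \<in> F. x \<notin> D}"
  proof (rule inj_onI, rule ccontr)
    fix D E assume "D \<in> {D \<in> F. x \<notin> D}" "E \<in> {D \<in> F. x \<notin> D}"
      and eq: "D - {- x} = E - {- x}" and ne: "D \<noteq> E"
    then have D: "D \<in> F" "x \<notin> D" and E: "E \<in> F" "x \<notin> E" by auto
    obtain z where z: "z \<in> D" "- z \<in> E" using uhit_clash[OF F D(1) E(1) ne] .
    have "z \<noteq> - x" using z E by auto
    then have "z \<in> E" using z eq by blast
    then show False using z uhit_clauseD(3)[OF F E(1), of z] by simp
  qed
  have "{B \<in> assign x F. y \<in> B} = (\<lambda>D. D - {- x}) ` {D \<in> F. x \<notin> D \<and> y \<in> D}"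
    unfolding assign_def using y by auto
  then have "ldeg (assign x F) y = card {D \<in> F. x \<notin> D \<and> y \<in> D}"
    unfolding ldeg_def by (simp add: card_image inj_on_subset[OF inj] Collect_mono_iff)
  also have "{D \<in> F. x \<notin> D \<and> y \<in> D} = {D \<in> F. y \<in> D} - {C}" using main by blast
  also have "card \<dots> = ldeg F y - (if y \<in> C then 1 else 0)"
    using CF uhit_finite[OF F] by (simp add: ldeg_def card_Diff_singleton_if)
  finally show ?thesis .
qed

lemma ldeg_eq_1_iff: "ldeg F x = 1 \<longleftrightarrow> (\<exists>C. {D \<in> F. x \<in> D} = {C})"
  unfolding ldeg_def by (simp add: card_1_singleton_iff)

lemma ldeg_eq_1D:
  assumes "ldeg F x = 1" "C \<in> F" "x \<in> C"
  shows "{D \<in> F. x \<in> D} = {C}"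
proof -
  obtain A where A: "{D \<in> F. x \<in> D} = {A}" using assms(1) ldeg_eq_1_iff[of F x] by blast
  moreover have "C \<in> {D \<in> F. x \<in> D}" using assms(2,3) by simp
  ultimately show ?thesis by simp
qed

lemma ldeg_pos_iff: "finite F \<Longrightarrow> ldeg F x > 0 \<longleftrightarrow> (\<exists>D\<in>F. x \<in> D)"
  unfolding ldeg_def by (auto simp: card_gt_0_iff)

lemma ldeg_uminus_pos:
  assumes "uhit F" "ldeg F x > 0"
  shows "ldeg F (- x) > 0"
  using assms uhit_complement_occurs[of F] by (auto simp: ldeg_pos_iff uhit_finite)

lemma ldeg_pos_nonzero:
  assumes "uhit F" "ldeg F x > 0"
  shows "x \<noteq> 0"
  using assms uhit_clauseD(2)[of F] by (auto simp: ldeg_pos_iff uhit_finite)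

text \<open>Complementary literals have degree 0 together, so the minimum in \<open>singular\<close>
  turns into a disjunction.\<close>

lemma singular_iff:
  assumes F: "uhit F"
  shows "singular F v \<longleftrightarrow> v > 0 \<and> (ldeg F v = 1 \<or> ldeg F (- v) = 1)"
proof -
  have "v > 0" if v: "v \<in> var F"
  proof -
    obtain D y where "D \<in> F" "y \<in> D" "v = \<bar>y\<bar>" using v unfolding var_def by blast
    moreover from this have "y \<noteq> 0" using uhit_clauseD(2)[OF F] by metis
    ultimately show ?thesis by simp
  qed
  moreover have "v \<in> var F" if "v > 0" and pos: "ldeg F v > 0"
  proof -
    obtain D where "D \<in> F" "v \<in> D" using pos ldeg_pos_iff[OF uhit_finite[OF F]] by blast
    then show ?thesis using \<open>v > 0\<close> unfolding var_def by (intro image_eqI[of _ _ v]) auto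
  qed
  moreover have "ldeg F v > 0 \<longleftrightarrow> ldeg F (- v) > 0"
    using ldeg_uminus_pos[OF F, of v] ldeg_uminus_pos[OF F, of "- v"] by auto
  ultimately show ?thesis unfolding singular_def by (auto simp: min_def)
qed

lemma one_singular_iff:
  assumes F: "uhit F"
  shows "one_singular F v \<longleftrightarrow> v > 0 \<and> ldeg F v = 1 \<and> ldeg F (- v) = 1"
  unfolding one_singular_def singular_iff[OF F] by auto

lemma sDP_iff:
  assumes F: "uhit F"
  shows "sDP F G \<longleftrightarrow> (\<exists>x. ldeg F x = 1 \<and> G = assign x F)"
proof
  assume "sDP F G"
  then obtain v where v: "singular F v" "G = DP v F" unfolding sDP_def by blast
  then consider "ldeg F v = 1" | "ldeg F (- v) = 1" using singular_iff[OF F] by blast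
  then show "\<exists>x. ldeg F x = 1 \<and> G = assign x F"
  proof cases
    case 1
    then show ?thesis using v DP_eq_assign(1)[OF F] ldeg_eq_1_iff by metis
  next
    case 2
    then show ?thesis using v DP_eq_assign(2)[OF F, of "- v"] ldeg_eq_1_iff
      by (metis minus_minus)
  qed
next
  assume "\<exists>x. ldeg F x = 1 \<and> G = assign x F"
  then obtain x where x: "ldeg F x = 1" "G = assign x F" by blast
  then obtain C where C: "{D \<in> F. x \<in> D} = {C}" using ldeg_eq_1_iff[of F x] by blast
  have "x \<noteq> 0" using ldeg_pos_nonzero[OF F] x by simp
  then have "singular F \<bar>x\<bar>" using x(1) unfolding singular_iff[OF F] by (auto simp: abs_if)
  moreover have "DP \<bar>x\<bar> F = G" using DP_eq_assign[OF F C] x(2) by (auto simp: abs_if)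
  ultimately show "sDP F G" unfolding sDP_def by blast
qed

lemma uhit_sDP: "uhit F \<Longrightarrow> sDP F G \<Longrightarrow> uhit G"
  using sDP_iff uhit_assign ldeg_pos_nonzero by fastforce

text \<open>Besides \<open>C\<close>, the literal \<open>y\<close> lies in every clause containing
  \<open>- x\<close>. Consequently degree 2 for \<open>y\<close> forces degree 1 for
  \<open>- x\<close>.\<close>

lemma ldeg_main_clause:
  assumes F: "uhit F" and C: "{D \<in> F. x \<in> D} = {C}" and y: "y \<in> C" "y \<noteq> x"
  shows "ldeg F y \<ge> Suc (ldeg F (- x))"
proof -
  have fin: "finite {D \<in> F. - x \<in> D}" "finite {D \<in> F. y \<in> D}" using uhit_finite[OF F] by auto
  have CF: "C \<in> F" "x \<in> C" using C by auto
  then have "C \<notin> {D \<in> F. - x \<in> D}" using uhit_clauseD(3)[OF F] by auto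
  then have "Suc (ldeg F (- x)) = card (insert C {D \<in> F. - x \<in> D})"
    unfolding ldeg_def by (rule card_insert_disjoint[OF fin(1), symmetric])
  also have "\<dots> \<le> ldeg F y"
    unfolding ldeg_def using main_clause_subset_side_clause[OF F C] CF y
    by (intro card_mono[OF fin(2)]) auto
  finally show ?thesis .
qed

text \<open>Other literals of the main clause of \<open>x\<close> have degree at least 2, so
  \<open>y\<close> lies outside it and keeps its degree.\<close>

lemma ldeg_assign_eq_1:
  assumes F: "uhit F" and x: "ldeg F x = 1" and y: "ldeg F y = 1" "y \<noteq> x" "y \<noteq> - x"
  shows "ldeg (assign x F) y = 1"
proof -
  obtain C where C: "{D \<in> F. x \<in> D} = {C}" using x ldeg_eq_1_iff[of F x] by blast
  have "y \<notin> C"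
    using ldeg_main_clause[OF F C, of y] ldeg_uminus_pos[OF F, of x] x y by auto
  then show ?thesis using ldeg_assign[OF F C] y by simp
qed

section \<open>Commutation of reductions\<close>

lemma assign_commute:
  assumes "y \<noteq> - x"
  shows "assign y (assign x F) = assign x (assign y F)"
proof -
  have "assign y (assign x F) = (\<lambda>D. D - {- x} - {- y}) ` {D \<in> F. x \<notin> D \<and> y \<notin> D}"
    if "y \<noteq> - x" for x y
  proof -
    have "{E \<in> assign x F. y \<notin> E} = (\<lambda>D. D - {- x}) ` {D \<in> F. x \<notin> D \<and> y \<notin> D}"
      using that unfolding assign_def by auto
    then show ?thesis unfolding assign_def[of y] by (simp add: image_image)
  qed
  from this[of y x] this[of x y] show ?thesis
    using assms by (simp add: Diff_insert2[symmetric] insert_commute conj_commute)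
qed

text \<open>Both sides are joined by exactly one further step; this is what makes lengths, and not
  just normal forms, comparable.\<close>

lemma sDP_diamond:
  assumes F: "uhit F" and "sDP F G" "sDP F H" and "G \<noteq> H"
  shows "\<exists>K. sDP G K \<and> sDP H K"
proof -
  obtain x where x: "ldeg F x = 1" "G = assign x F" using assms(2) sDP_iff[OF F, of G] by blast
  obtain y where y: "ldeg F y = 1" "H = assign y F" using assms(3) sDP_iff[OF F, of H] by blast
  obtain C where C: "{E \<in> F. x \<in> E} = {C}" using x(1) ldeg_eq_1_iff[of F x] by blast
  obtain D where D: "{E \<in> F. y \<in> E} = {D}" using y(1) ldeg_eq_1_iff[of F y] by blast
  have "y \<noteq> x" using x y \<open>G \<noteq> H\<close> by auto
  \<comment> \<open>For \<open>y = - x\<close> both reductions are DP on the same variable, whence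
    \<open>G = H\<close>.\<close>
  moreover have "y \<noteq> - x"
    using x(2) y(2) \<open>G \<noteq> H\<close> DP_eq_assign(1)[OF F D] DP_eq_assign(2)[OF F C] by auto
  ultimately have "ldeg G y = 1" "ldeg H x = 1" "assign y G = assign x H"
    using ldeg_assign_eq_1[OF F x(1) y(1)] ldeg_assign_eq_1[OF F y(1) x(1)] assign_commute[of y x F]
      x(2) y(2) by auto
  moreover have "uhit G" "uhit H" using uhit_sDP[OF F] assms(2,3) by blast+
  ultimately have "sDP G (assign y G)" "sDP H (assign y G)" using sDP_iff by blast+
  then show ?thesis by blast
qed

section \<open>Decrease of the singularity measure\<close>

text \<open>After the reduction, two such literals would both occur in a single clause only, but
  a clause containing the complement of one of them would have to contain the other.\<close>

lemma degree_two_literal_unique: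
  assumes F: "uhit F" and C: "{D \<in> F. x \<in> D} = {C}"
    and y: "y \<in> C" "y \<noteq> x" "ldeg F y = 2" and z: "z \<in> C" "z \<noteq> x" "ldeg F z = 2"
  shows "y = z"
proof (rule ccontr)
  assume "y \<noteq> z"
  let ?G = "assign x F"
  have CF: "C \<in> F" "x \<in> C" using C by auto
  have ne: "y \<noteq> - x" "z \<noteq> - x" "x \<noteq> 0" using uhit_clauseD[OF F CF(1)] CF y z by auto
  have G: "uhit ?G" using uhit_assign[OF F ne(3)] .
  obtain D where D: "D \<in> F" "- x \<in> D" using uhit_complement_occurs[OF F CF] by blast
  then have "x \<notin> D" using uhit_clauseD(3)[OF F, of D x] by auto
  then have DG: "D - {- x} \<in> ?G" "y \<in> D - {- x}" "z \<in> D - {- x}"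
    using main_clause_subset_side_clause[OF F C D] D y z ne unfolding assign_def by auto
  have "ldeg ?G y = 1" "ldeg ?G z = 1" using ldeg_assign[OF F C] ne y z by auto
  then have Y: "{E \<in> ?G. y \<in> E} = {D - {- x}}" and Z: "{E \<in> ?G. z \<in> E} = {D - {- x}}"
    using ldeg_eq_1D DG by simp_all
  obtain B where B: "B \<in> ?G" "- y \<in> B" using uhit_complement_occurs[OF G DG(1,2)] by blast
  \<comment> \<open>The inclusion is applied inside \<open>?G\<close>, where \<open>y\<close> has
    degree 1. Since \<open>z\<close> also has degree 1 there, \<open>B\<close> must be the clause
    that already contains \<open>y\<close>.\<close>
  then have "z \<in> B" using main_clause_subset_side_clause[OF G Y B] DG \<open>y \<noteq> z\<close> by auto
  then have "B = D - {- x}" using B Z by blast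
  then show False using B DG uhit_clauseD(3)[OF G DG(1), of y] by auto
qed

lemma finite_singular: "uhit F \<Longrightarrow> finite {v. singular F v}"
  using uhit_finite[of F] uhit_clauseD(1)[of F]
  by (auto intro!: finite_subset[of _ "var F"] simp: singular_def var_def)

text \<open>Two cardinalities of nested sets allow the comparison before and after a step by
  inclusions.\<close>

lemma singularity_measure_eq:
  assumes "uhit F"
  shows "2 * nosv F + nnosv F = card {v. singular F v} + card {v. one_singular F v}"
proof -
  have "{v. singular F v} = {v. one_singular F v} \<union> {v. singular F v \<and> \<not> one_singular F v}"
    by (auto simp: one_singular_def)
  then have "card {v. singular F v} = nosv F + nnosv F"
    unfolding nosv_def nnosv_def using finite_singular[OF assms]
    by (metis (no_types, lifting) card_Un_disjoint disjoint_iff finite_Un mem_Collect_eq)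
  then show ?thesis by (simp add: nosv_def)
qed

lemma singularity_measure_decreases:
  assumes F: "uhit F" and "sDP F G"
  shows "2 * nosv G + nnosv G < 2 * nosv F + nnosv F"
proof -
  obtain x where x: "ldeg F x = 1" "G = assign x F" using assms(2) sDP_iff[OF F, of G] by blast
  obtain C where C: "{D \<in> F. x \<in> D} = {C}" using x(1) ldeg_eq_1_iff[of F x] by blast
  have G: "uhit G" using uhit_sDP assms .
  have x0: "x \<noteq> 0" using ldeg_pos_nonzero[OF F] x by simp
  have CF: "C \<in> F" "x \<in> C" using C by auto
  have mx: "ldeg F (- x) > 0" using ldeg_uminus_pos[OF F] x by simp
  define v where "v = \<bar>x\<bar>"
  define S where "S = (\<lambda>F. {w. singular F w})"
  define S1 where "S1 = (\<lambda>F. {w. one_singular F w})"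
  have fin: "finite (S F)" "finite (S1 F)" "finite (S G)" "finite (S1 G)"
    using finite_singular[OF F] finite_singular[OF G]
    by (auto simp: S_def S1_def one_singular_def)
  have vS: "v \<in> S F" using x x0 by (auto simp: S_def v_def singular_iff[OF F] abs_if)
  have dG: "ldeg G y = ldeg F y - (if y \<in> C then 1 else 0)" if "y \<noteq> - x" for y
    using ldeg_assign[OF F C that] x(2) by simp
  have "ldeg G x = 0" using dG[of x] x CF x0 by simp
  then have "ldeg G (- x) = 0" using ldeg_uminus_pos[OF G, of "- x"] by auto
  then have vG: "v \<notin> S G" "v \<notin> S1 G"
    using \<open>ldeg G x = 0\<close>
    by (auto simp: S_def S1_def v_def singular_iff[OF G] one_singular_iff[OF G] abs_if split: if_splits)
  have big: "ldeg F y \<ge> Suc (ldeg F (- x))" if "y \<in> C" "y \<noteq> x" for y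
    using ldeg_main_clause[OF F C that] .
  \<comment> \<open>The literals whose degree drops from 2 to 1: the only source of new
    singularity.\<close>
  define N where "N = {y \<in> C. y \<noteq> x \<and> ldeg F y = 2}"
  have deg1: "ldeg F y = 1 \<or> y \<in> N" if "ldeg G y = 1" for y
  proof -
    have ne: "y \<noteq> - x" "y \<noteq> x" using that \<open>ldeg G x = 0\<close> \<open>ldeg G (- x) = 0\<close> by auto
    have eq: "ldeg F y - (if y \<in> C then 1 else 0) = 1" using dG[OF ne(1)] that by argo
    show ?thesis
    proof (cases "y \<in> C")
      case True
      then have "ldeg F y = 2" using eq by simp
      then show ?thesis using True ne(2) unfolding N_def by blast
    next
      case False
      then show ?thesis using eq by simp
    qed
  qed
  have "card (S G) + card (S1 G) < card (S F) + card (S1 F)"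
  proof (cases "N = {}")
    case True
    have "S G \<subseteq> S F - {v}" "S1 G \<subseteq> S1 F"
      using deg1 True vG by (auto simp: S_def S1_def singular_iff[OF G] one_singular_iff[OF G]
          singular_iff[OF F] one_singular_iff[OF F])
    then have "card (S G) < card (S F)" "card (S1 G) \<le> card (S1 F)"
      using fin vS by (auto intro!: psubset_card_mono card_mono)
    then show ?thesis by simp
  next
    case False
    then obtain y where y: "y \<in> N" by blast
    have N: "N = {y}" using degree_two_literal_unique[OF F C] y by (auto simp: N_def)
    \<comment> \<open>Now \<open>v\<close> is 1-singular, so it leaves both \<open>S\<close> and
      \<open>S1\<close>, while only the variable of \<open>y\<close> can enter.\<close>
    have "ldeg F (- x) = 1" using big[of y] y mx by (auto simp: N_def)
    then have vS1: "v \<in> S1 F"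
      using x x0 by (auto simp: S1_def v_def one_singular_iff[OF F] abs_if)
    have sub: "S G \<subseteq> insert \<bar>y\<bar> (S F - {v})" "S1 G \<subseteq> insert \<bar>y\<bar> (S1 F - {v})"
      using deg1 vG unfolding N by (fastforce simp: S_def S1_def singular_iff[OF G]
          one_singular_iff[OF G] singular_iff[OF F] one_singular_iff[OF F])+
    have le: "card (insert \<bar>y\<bar> (A - {v})) \<le> card A" if "finite A" "v \<in> A" for A
      using that by (metis card_insert_le_m1 card_gt_0_iff card_Diff_singleton empty_iff le_refl)
    have less: "card B < card A" if "finite A" "v \<in> A" "B \<subseteq> A - {v}" for A B :: "int set"
      using that by (intro psubset_card_mono) auto
    show ?thesis
    \<comment> \<open>Entering both sets as a new element is impossible: if the variable of
      \<open>y\<close> is 1-singular in \<open>G\<close>, then \<open>- y\<close>, not being in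
      \<open>N\<close>, had degree 1 in \<open>F\<close> already, so the variable was singular
      before. Hence at least one of the two sets strictly shrinks.\<close>
    proof (cases "\<bar>y\<bar> \<in> S1 G")
      case False
      then have "S1 G \<subseteq> S1 F - {v}" using sub(2) by blast
      then have "card (S1 G) < card (S1 F)" using less fin vS1 by blast
      moreover have "card (S G) \<le> card (S F)"
        using le[OF fin(1) vS] card_mono[OF _ sub(1)] fin by simp
      ultimately show ?thesis by simp
    next
      case True
      then have "ldeg G (- y) = 1" "y \<noteq> 0"
        by (auto simp: S1_def one_singular_iff[OF G] abs_if split: if_splits)
      moreover have "- y \<notin> N" using N \<open>y \<noteq> 0\<close> by auto
      ultimately have "ldeg F (- y) = 1" using deg1 by blast
      then have "\<bar>y\<bar> \<in> S F" using \<open>y \<noteq> 0\<close> by (auto simp: S_def singular_iff[OF F] abs_if)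
      then have "S G \<subseteq> S F - {v}" using sub(1) vG by blast
      then have "card (S G) < card (S F)" using less fin vS by blast
      moreover have "card (S1 G) \<le> card (S1 F)"
        using le[OF fin(2) vS1] card_mono[OF _ sub(2)] fin by simp
      ultimately show ?thesis by simp
    qed
  qed
  then show ?thesis
    using singularity_measure_eq[OF F] singularity_measure_eq[OF G] by (simp add: S_def S1_def)
qed

section \<open>Maximal reduction sequences and their common length\<close>

lemma maximal_sDP_sequence_exists:
  assumes "uhit F"
  shows "\<exists>n \<le> 2 * nosv F + nnosv F. \<exists>G. (sDP ^^ n) F G \<and> (\<nexists>H. sDP G H)"
  using assms
proof (induction "2 * nosv F + nnosv F" arbitrary: F rule: less_induct)
  case less
  show ?case
  proof (cases "\<exists>H. sDP F H")
    case False
    then show ?thesis by (intro exI[of _ 0]) auto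
  next
    case True
    then obtain H where H: "sDP F H" by blast
    note lt = singularity_measure_decreases[OF less.prems H]
    obtain n G where "n \<le> 2 * nosv H + nnosv H" "(sDP ^^ n) H G" "\<nexists>K. sDP G K"
      using less.hyps[OF lt uhit_sDP[OF less.prems H]] by blast
    moreover from this(2) have "(sDP ^^ Suc n) F G" using relpowp_Suc_I2[of sDP F H n G] H by blast
    ultimately show ?thesis using lt by (intro exI[of _ "Suc n"]) auto
  qed
qed

text \<open>If the first steps differ, the diamond joins them in \<open>K\<close>. A maximal
  sequence of length \<open>k\<close> from \<open>K\<close> yields one of length
  \<open>Suc k\<close> from each of \<open>G1\<close> and \<open>H1\<close>, and the induction
  hypotheses equate both given tails with it.\<close>

lemma maximal_sDP_sequence_length_unique:
  assumes "uhit F"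
    and "(sDP ^^ n) F G" "\<nexists>K. sDP G K" and "(sDP ^^ m) F H" "\<nexists>K. sDP H K"
  shows "n = m"
  using assms
proof (induction "2 * nosv F + nnosv F" arbitrary: F n m G H rule: less_induct)
  case less
  note F = less.prems(1)
  show ?case
  proof (cases "\<exists>K. sDP F K")
    case False
    then have "n = 0" "m = 0"
      using less.prems(2,4) by (metis not0_implies_Suc relpowp_Suc_D2)+
    then show ?thesis by simp
  next
    case True
    then have "n \<noteq> 0" "m \<noteq> 0" using less.prems(2-5) by (metis relpowp_0_E)+
    then obtain n' m' where nm: "n = Suc n'" "m = Suc m'" using not0_implies_Suc by metis
    obtain G1 where G1: "sDP F G1" "(sDP ^^ n') G1 G"
      using less.prems(2) relpowp_Suc_D2[of n' sDP F G] unfolding nm by blast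
    obtain H1 where H1: "sDP F H1" "(sDP ^^ m') H1 H"
      using less.prems(4) relpowp_Suc_D2[of m' sDP F H] unfolding nm by blast
    note IHG = less.hyps[OF singularity_measure_decreases[OF F G1(1)] uhit_sDP[OF F G1(1)]]
    note IHH = less.hyps[OF singularity_measure_decreases[OF F H1(1)] uhit_sDP[OF F H1(1)]]
    have "n' = m'"
    proof (cases "G1 = H1")
      case True
      then show ?thesis using IHG G1 H1 less.prems by blast
    next
      case False
      then obtain K where K: "sDP G1 K" "sDP H1 K" using sDP_diamond[OF F G1(1) H1(1)] by blast
      have "uhit K" using uhit_sDP[OF uhit_sDP[OF F G1(1)] K(1)] .
      then obtain k L where L: "(sDP ^^ k) K L" "\<nexists>M. sDP L M"
        using maximal_sDP_sequence_exists by blast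
      then have "(sDP ^^ Suc k) G1 L" "(sDP ^^ Suc k) H1 L"
        using relpowp_Suc_I2[of sDP _ K k L] K by blast+
      then have "n' = Suc k" "m' = Suc k"
        using IHG[OF G1(2) less.prems(3) _ L(2)] IHH[OF H1(2) less.prems(5) _ L(2)] by blast+
      then show ?thesis by simp
    qed
    then show ?thesis using nm by simp
  qed
qed

theorem corollary7:
  fixes F :: "clause set"
  assumes "is_clause_set F" and "\<not> satisfiable F" and "hitting F"
  shows "singind F \<le> 2 * nosv F + nnosv F"
proof -
  have F: "uhit F" using assms by (simp add: uhit_def)
  then obtain n where n: "n \<le> 2 * nosv F + nnosv F" "\<exists>G. (sDP ^^ n) F G \<and> (\<nexists>H. sDP G H)"
    using maximal_sDP_sequence_exists by blast
  \<comment> \<open>Existence and uniqueness together give the definite description in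
    \<open>singind\<close> its value.\<close>
  have "singind F = n"
    unfolding singind_def
    using n(2) maximal_sDP_sequence_length_unique[OF F] by (intro the_equality) blast+
  then show ?thesis using n(1) by simp
qed

end
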